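(* Let $\Delta$ be a positive integer, and let $M$, $R$, $I$ and $\mathbf{b}_{ijk\ell}$ be as defined in the context. The $R\times I$ submatrix of $M$ (rows of $M$ indexed by $R$ in lexicographic order, columns of $M$ indexed by $I$ in the order induced by the correspondence $xy\mapsto ijk\ell$ from $R$) is upper-triangular with nonzero diagonal entries. In particular, $$\{\mathbf{b}_{ijk\ell} \mid ijk\ell\in I\}$$ is a lattice basis for $B_\Delta$, i.e. a basis of $\ker_{\mathbb{Z}}(B_\Delta)$ as a free $\mathbb{Z}$-module.
   Context: For a positive integer $\Delta$, $B_\Delta$ is the $(3\Delta-1)\times\binom{\Delta+1}{2}$ integer matrix whose columns are indexed by pairs $ij$ with $1\le i\le j\le\Delta$ (in lexicographic order) and whose entries are as follows. For a row $a$ with $1\le a\le\Delta$, $B_\Delta(a,ij)=2$ if $i=j=a$, $=1$ if exactly one of $i,j$ equals $a$, and $=0$ otherwise. For $2\le\kappa\le2\Delta$, the row $\kappa+\Delta-1$ has $B_\Delta(\kappa+\Delta-1,ij)=1$ if $i+j=\kappa$ and $0$ otherwise. $\ker_{\mathbb{Z}}(B_\Delta)$ is the set of integer vectors $\mathbf{x}$ with $B_\Delta\mathbf{x}=\mathbf{0}$. For $i,j\in\{1,\dots,\Delta\}$ (not necessarily distinct or ordered), $\mathbf{e}_{ij}=\mathbf{e}_{ji}$ denotes the standard basis vector of $\mathbb{Z}^{\binom{\Delta+1}{2}}$ indexed by the unordered pair $\{i,j\}$. For integers $1\le i<j<k<\ell\le\Delta$, put $a=i+\ell-j$, $b=i+k-j$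 and $$\mathbf{b}_{ijk\ell}=\mathbf{e}_{i\ell}+\mathbf{e}_{ak}+\mathbf{e}_{jb}-\mathbf{e}_{ik}-\mathbf{e}_{ja}-\mathbf{e}_{b\ell}.$$ $M$ is the $\binom{\Delta+1}{2}\times\binom{\Delta}{4}$ matrix whose rows are indexed by pairs $uv$ with $1\le u\le v\le\Delta$, lexicographically ordered, and whose columns are the vectors $\mathbf{b}_{ijk\ell}$ for $1\le i<j<k<\ell\le\Delta$. Set $$R=\{xy \mid 2<x\le y<\Delta\},$$ $$I=\{ijk\ell \mid i=1,\ j=y-x+2,\ k=y,\ \ell=y+1 \text{ for each } xy\in R\},$$ so that each $xy\in R$ corresponds to exactly one $ijk\ell\in I$, and $i<j<k<\ell$ for each such element. *)

theory Defs
  imports "Jordan_Normal_Form.Matrix_Kernel"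
begin

text \<open>
  Matrices and vectors of Jordan-Normal-Form are indexed by natural numbers starting at 0. The
  labels of rows and columns (pairs, quadruples) are therefore kept in explicit lists, and a label
  is translated into its position in the list.
\<close>

definition pairs :: "nat \<Rightarrow> (nat \<times> nat) list" where
  "pairs \<Delta> = [(u, v). u \<leftarrow> [1..<Suc \<Delta>], v \<leftarrow> [u..<Suc \<Delta>]]"

definition quads :: "nat \<Rightarrow> (nat \<times> nat \<times> nat \<times> nat) list" where
  "quads \<Delta> = [(i, j, k, l). i \<leftarrow> [1..<Suc \<Delta>], j \<leftarrow> [Suc i..<Suc \<Delta>],
                             k \<leftarrow> [Suc j..<Suc \<Delta>], l \<leftarrow> [Suc k..<Suc \<Delta>]]"

definition pos :: "'a list \<Rightarrow> 'a \<Rightarrow> nat" where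
  "pos xs x = (LEAST p. p < length xs \<and> xs ! p = x)"

text \<open>
  The entry of \<open>B\<close> in row \<open>r\<close> (counted from 1, as in the mathematical definition) and column
  \<open>ij\<close>; the row \<open>r = \<kappa> + \<Delta> - 1\<close> with \<open>2 \<le> \<kappa>\<close> belongs to \<open>\<kappa> = r + 1 - \<Delta>\<close>.
\<close>

definition B_entry :: "nat \<Rightarrow> nat \<Rightarrow> nat \<times> nat \<Rightarrow> int" where
  "B_entry \<Delta> r = (\<lambda>(i, j).
     if r \<le> \<Delta> then (if i = r \<and> j = r then 2 else if (i = r) \<noteq> (j = r) then 1 else 0)
     else (if i + j = r + 1 - \<Delta> then 1 else 0))"

definition B_mat :: "nat \<Rightarrow> int mat" where
  "B_mat \<Delta> = mat (3 * \<Delta> - 1) (length (pairs \<Delta>)) (\<lambda>(r, c). B_entry \<Delta> (r + 1) (pairs \<Delta> ! c))"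

definition e_vec :: "nat \<Rightarrow> nat \<Rightarrow> nat \<Rightarrow> int vec" where
  "e_vec \<Delta> i j = unit_vec (length (pairs \<Delta>)) (pos (pairs \<Delta>) (min i j, max i j))"

text \<open>
  For \<open>i < j < k < l\<close> the truncated subtractions below are exact.
\<close>

definition b_vec :: "nat \<Rightarrow> nat \<times> nat \<times> nat \<times> nat \<Rightarrow> int vec" where
  "b_vec \<Delta> = (\<lambda>(i, j, k, l). let a = i + l - j; b = i + k - j in
     e_vec \<Delta> i l + e_vec \<Delta> a k + e_vec \<Delta> j b - e_vec \<Delta> i k - e_vec \<Delta> j a - e_vec \<Delta> b l)"

definition M_mat :: "nat \<Rightarrow> int mat" where
  "M_mat \<Delta> = mat_of_cols (length (pairs \<Delta>)) (map (b_vec \<Delta>) (quads \<Delta>))"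

definition R_set :: "nat \<Rightarrow> (nat \<times> nat) set" where
  "R_set \<Delta> = {(x, y). 2 < x \<and> x \<le> y \<and> y < \<Delta>}"

text \<open>The correspondence from \<open>R\<close> to \<open>I\<close>; the subtraction is exact on \<open>R\<close>.\<close>

definition R_to_I :: "nat \<times> nat \<Rightarrow> nat \<times> nat \<times> nat \<times> nat" where
  "R_to_I = (\<lambda>(x, y). (1, y - x + 2, y, y + 1))"

definition I_set :: "nat \<Rightarrow> (nat \<times> nat \<times> nat \<times> nat) set" where
  "I_set \<Delta> = R_to_I ` R_set \<Delta>"

definition R_list :: "nat \<Rightarrow> (nat \<times> nat) list" where
  "R_list \<Delta> = filter (\<lambda>p. p \<in> R_set \<Delta>) (pairs \<Delta>)"

definition I_list :: "nat \<Rightarrow> (nat \<times> nat \<times> nat \<times> nat) list" where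
  "I_list \<Delta> = map R_to_I (R_list \<Delta>)"

definition submatrix_by :: "'a mat \<Rightarrow> nat list \<Rightarrow> nat list \<Rightarrow> 'a mat" where
  "submatrix_by A rs cs = mat (length rs) (length cs) (\<lambda>(p, q). A $$ (rs ! p, cs ! q))"

definition M_R_I :: "nat \<Rightarrow> int mat" where
  "M_R_I \<Delta> = submatrix_by (M_mat \<Delta>) (map (pos (pairs \<Delta>)) (R_list \<Delta>))
                                     (map (pos (quads \<Delta>)) (I_list \<Delta>))"

text \<open>
  Linear independence and span are those of the \<open>\<int>\<close>-module of integer vectors of dimension
  \<open>dim_col A\<close>; the integer kernel \<open>mat_kernel A\<close> is a submodule of it.
\<close>

definition lattice_basis :: "int mat \<Rightarrow> int vec set \<Rightarrow> bool" where
  "lattice_basis A S \<longleftrightarrow>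
     S \<subseteq> mat_kernel A \<and>
     \<not> LinearCombinations.module.lin_dep class_ring (module_vec TYPE(int) (dim_col A)) S \<and>
     LinearCombinations.module.span class_ring (module_vec TYPE(int) (dim_col A)) S = mat_kernel A"


lemma set_pairs: "set (pairs \<Delta>) = {(u, v). 1 \<le> u \<and> u \<le> v \<and> v \<le> \<Delta>}"
  unfolding pairs_def by (auto simp: image_iff simp del: upt_Suc)

lemma set_quads:
  "set (quads \<Delta>) = {(i, j, k, l). 1 \<le> i \<and> i < j \<and> j < k \<and> k < l \<and> l \<le> \<Delta>}"
  unfolding quads_def by (auto simp: image_iff simp del: upt_Suc)

lemma sorted_wrt_concat_map:
  assumes "sorted_wrt (<) (xs :: nat list)" and "\<And>x. x \<in> set xs \<Longrightarrow> sorted_wrt P (f x)"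
    and "\<And>x y p q. x < y \<Longrightarrow> p \<in> set (f x) \<Longrightarrow> q \<in> set (f y) \<Longrightarrow> P p q"
  shows "sorted_wrt P (concat (map f xs))"
  using assms by (induction xs) (auto simp: sorted_wrt_append)

lemma pairs_lexicographic:
  "sorted_wrt (\<lambda>(u, v) (u', v'). u < u' \<or> u = u' \<and> v < v') (pairs \<Delta>)"
  unfolding pairs_def
  by (rule sorted_wrt_concat_map) (auto simp: sorted_wrt_map simp del: upt_Suc)

lemma distinct_pairs: "distinct (pairs \<Delta>)"
  using pairs_lexicographic
  unfolding sorted_wrt_iff_nth_less distinct_conv_nth
  by (metis (no_types, lifting) case_prod_unfold less_irrefl nat_neq_iff)

lemma length_pairs: "length (pairs \<Delta>) = (\<Delta> + 1) choose 2"
proof -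
  have "length (pairs \<Delta>) = (\<Sum>u\<leftarrow>[1..<Suc \<Delta>]. Suc \<Delta> - u)"
    unfolding pairs_def by (simp add: length_concat comp_def del: upt_Suc)
  also have "\<dots> = (\<Sum>u\<in>{1..<Suc \<Delta>}. Suc \<Delta> - u)"
    by (simp add: sum_list_distinct_conv_sum_set del: upt_Suc)
  also have "\<dots> = (\<Sum>u\<in>{1..<Suc \<Delta>}. u)"
    by (rule sum.reindex_bij_witness[of _ "\<lambda>u. Suc \<Delta> - u" "\<lambda>u. Suc \<Delta> - u"]) auto
  also have "\<dots> = \<Sum>{0..\<Delta>}"
    by (rule sum.mono_neutral_left) auto
  also have "\<dots> = (\<Delta> + 1) choose 2"
    by (simp add: gauss_sum_nat choose_two mult.commute)
  finally show ?thesis .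
qed

lemma pos:
  assumes "x \<in> set xs"
  shows "pos xs x < length xs" and "xs ! pos xs x = x"
proof -
  have "\<exists>p. p < length xs \<and> xs ! p = x"
    using assms by (simp add: in_set_conv_nth)
  from LeastI_ex[OF this] show "pos xs x < length xs" and "xs ! pos xs x = x"
    unfolding pos_def by auto
qed

lemma set_R_list: "set (R_list \<Delta>) = R_set \<Delta>"
  unfolding R_list_def R_set_def set_filter set_pairs by auto

lemma set_I_list: "set (I_list \<Delta>) = I_set \<Delta>"
  unfolding I_list_def I_set_def set_map set_R_list ..

lemma I_set_subset: "I_set \<Delta> \<subseteq> set (quads \<Delta>)"
  unfolding I_set_def R_to_I_def R_set_def set_quads by auto

lemma inj_on_R_to_I: "inj_on R_to_I (R_set \<Delta>)"
  unfolding R_to_I_def R_set_def by (auto simp: inj_on_def)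

end

theory Submission
  imports Defs
begin

text \<open>
  For \<open>xy \<in> R\<close> the vector of \<open>R_to_I (x, y)\<close> is
  \<open>e(1,y+1) + e(x,y) + e(y-x+2,x-1) - e(1,y) - e(y-x+2,x) - e(x-1,y+1)\<close>; among the labels in
  \<open>R\<close>, \<open>xy\<close> is lexicographically the largest one occurring, and it occurs with coefficient 1.
  Thus the submatrix is unitriangular over the integers, so the vectors are independent, and every
  kernel vector can be reduced by them to one vanishing on \<open>R\<close>. Such a vector lives on the pairs
  \<open>1j\<close>, \<open>2j\<close>, \<open>i\<Delta>\<close>, where the equations of \<open>B\<close> force it to be zero.
\<close>

section \<open>Lattice bases from unitriangular families in an integer kernel\<close>

lemma mat_kernel_submodule:
  fixes A :: "int mat"
  shows "submodule class_ring (mat_kernel A) (module_vec TYPE(int) (dim_col A))"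
proof -
  interpret V: vec_module "TYPE(int)" "dim_col A" .
  have A: "A \<in> carrier_mat (dim_row A) (dim_col A)" by simp
  note D = mat_kernelD[OF A]
  show ?thesis
  proof (rule submodule.intro)
    show "module class_ring (module_vec TYPE(int) (dim_col A))"
      by (rule V.module_axioms)
    show "mat_kernel A \<subseteq> carrier (module_vec TYPE(int) (dim_col A))"
      unfolding module_vec_simps by (rule mat_kernel_carrier[OF A])
    show "\<zero>\<^bsub>module_vec TYPE(int) (dim_col A)\<^esub> \<in> mat_kernel A"
      unfolding module_vec_simps by (rule mat_kernelI[OF A]) auto
  next
    fix v w assume "v \<in> mat_kernel A" "w \<in> mat_kernel A"
    then show "v \<oplus>\<^bsub>module_vec TYPE(int) (dim_col A)\<^esub> w \<in> mat_kernel A"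
      unfolding module_vec_simps
      by (intro mat_kernelI[OF A]) (simp_all add: D mult_add_distrib_mat_vec[OF A])
  next
    fix c :: int and v assume "v \<in> mat_kernel A"
    then show "c \<odot>\<^bsub>module_vec TYPE(int) (dim_col A)\<^esub> v \<in> mat_kernel A"
      unfolding module_vec_simps by (rule mat_kernel_smult[OF A])
  qed
qed

text \<open>Pivots equal to 1 allow elimination without division. In a vanishing combination, the
  coordinate at the last pivot with nonzero coefficient isolates that coefficient. For spanning,
  pivot coordinates are cleared from the last to the first, and \<open>zero\<close> disposes of the
  remainder.\<close>

lemma lattice_basis_of_unitriangular:
  fixes A :: "int mat"
  assumes len: "length ps = length ws"
    and ps: "\<And>p. p < length ws \<Longrightarrow> ps ! p < dim_col A"
    and ws: "set ws \<subseteq> mat_kernel A"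
    and diag: "\<And>p. p < length ws \<Longrightarrow> ws ! p $ (ps ! p) = 1"
    and below: "\<And>p q. p < length ws \<Longrightarrow> q < p \<Longrightarrow> ws ! q $ (ps ! p) = 0"
    and zero: "\<And>v. v \<in> mat_kernel A \<Longrightarrow> (\<And>p. p < length ws \<Longrightarrow> v $ (ps ! p) = 0)
                 \<Longrightarrow> v = 0\<^sub>v (dim_col A)"
  shows "lattice_basis A (set ws)"
proof -
  let ?n = "dim_col A"
  interpret V: vec_module "TYPE(int)" ?n .
  have carrier: "mat_kernel A \<subseteq> carrier_vec ?n"
    by (rule mat_kernel_carrier) auto
  then have wsc: "set ws \<subseteq> carrier_vec ?n" using ws by blast
  note kernel = mat_kernel_submodule[of A]
  note span = V.span_is_submodule[OF wsc]
  have indpt: "\<not> V.lin_dep (set ws)"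
  proof
    assume "V.lin_dep (set ws)"
    then obtain S a w where S: "finite S" "S \<subseteq> set ws" and comb: "V.lincomb a S = 0\<^sub>v ?n"
      and w: "w \<in> S" "a w \<noteq> 0"
      unfolding V.lin_dep_def by auto
    \<comment> \<open>Coefficients are attached to vectors, but triangularity speaks of positions;
      the largest position carrying a nonzero coefficient is the one to evaluate at.\<close>
    define Q where "Q = {p. p < length ws \<and> ws ! p \<in> S \<and> a (ws ! p) \<noteq> 0}"
    have finQ: "finite Q" unfolding Q_def by simp
    have "Q \<noteq> {}" using w S(2) unfolding Q_def by (auto simp: in_set_conv_nth subset_iff)
    with finQ have maxQ: "Max Q \<in> Q" by (rule Max_in)
    define m where "m = Max Q"
    have m: "m < length ws" "ws ! m \<in> S" "a (ws ! m) \<noteq> 0"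
      using maxQ unfolding m_def Q_def by auto
    have Sc: "S \<subseteq> carrier_vec ?n" using S(2) wsc by blast
    have "0 = V.lincomb a S $ (ps ! m)" using comb ps[OF m(1)] by simp
    also have "\<dots> = (\<Sum>x\<in>S. (a x \<cdot>\<^sub>v x) $ (ps ! m))"
      unfolding V.lincomb_def by (rule V.finsum_index[OF ps[OF m(1)] _ Sc]) (use Sc in auto)
    also have "\<dots> = (\<Sum>x\<in>S. if x = ws ! m then a x else 0)"
    proof (rule sum.cong[OF refl])
      fix x assume x: "x \<in> S"
      then obtain q where q: "q < length ws" "x = ws ! q"
        using S(2) by (auto simp: in_set_conv_nth subset_iff)
      have ax: "a x = 0" if "m < q"
      proof (rule ccontr)
        assume "a x \<noteq> 0"
        then have "q \<in> Q" using q x unfolding Q_def by auto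
        then show False using Max_ge[OF finQ] that unfolding m_def by fastforce
      qed
      have "(a x \<cdot>\<^sub>v x) $ (ps ! m) = a x * x $ (ps ! m)"
        using x Sc ps[OF m(1)] by auto
      \<comment> \<open>For \<open>q < m\<close> the entry is 0, and \<open>x = ws ! m\<close> is
        excluded because its entry would also be 1. For \<open>m < q\<close> the coefficient is 0 by
        maximality of \<open>m\<close>.\<close>
      also have "\<dots> = (if x = ws ! m then a x else 0)"
        using ax below[OF m(1), of q] diag[OF m(1)] q by (cases m q rule: linorder_cases) auto
      finally show "(a x \<cdot>\<^sub>v x) $ (ps ! m) = (if x = ws ! m then a x else 0)" .
    qed
    also have "\<dots> = a (ws ! m)" using S(1) m(2) by simp
    finally show False using m(3) by simp
  qed
  have reduce: "v \<in> V.span (set ws)"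
    if "v \<in> mat_kernel A" "m \<le> length ws"
      "\<And>p. m \<le> p \<Longrightarrow> p < length ws \<Longrightarrow> v $ (ps ! p) = 0" for v m
    using that
  proof (induction m arbitrary: v)
    case 0
    then have "v = 0\<^sub>v ?n" using zero by simp
    then show ?case using span unfolding submodule_def by (auto simp: module_vec_simps)
  next
    case (Suc m)
    \<comment> \<open>Adding \<open>?w\<close> clears the coordinate \<open>ps ! m\<close>; the
      later pivot coordinates stay zero because \<open>ws ! m\<close> vanishes there.\<close>
    let ?w = "- (v $ (ps ! m)) \<cdot>\<^sub>v ws ! m"
    have m: "m < length ws" using Suc.prems(2) by simp
    have wm: "ws ! m \<in> set ws" using m by simp
    then have wk: "ws ! m \<in> mat_kernel A" and wc: "ws ! m \<in> carrier_vec ?n"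
      using ws wsc by auto
    have vc: "v \<in> carrier_vec ?n" using Suc.prems(1) carrier by blast
    have "v + ?w \<in> mat_kernel A"
      using kernel wk Suc.prems(1) unfolding submodule_def
      by (auto simp: module_vec_simps class_ring_simps)
    moreover have "(v + ?w) $ (ps ! p) = 0" if "m \<le> p" "p < length ws" for p
      using that Suc.prems(3)[of p] below[of p m] diag[of p] ps[of p] vc wc
      by (cases "p = m") auto
    ultimately have red: "v + ?w \<in> V.span (set ws)"
      using Suc.IH m by simp
    have "ws ! m \<in> V.span (set ws)"
      using V.in_own_span[OF wsc] wm by blast
    then have "(v + ?w) + v $ (ps ! m) \<cdot>\<^sub>v ws ! m \<in> V.span (set ws)"
      using span red unfolding submodule_def
      by (auto simp: module_vec_simps class_ring_simps)
    also have "(v + ?w) + v $ (ps ! m) \<cdot>\<^sub>v ws ! m = v"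
      using vc wc by (intro eq_vecI) auto
    finally show ?case .
  qed
  have "V.span (set ws) = mat_kernel A"
  proof
    show "V.span (set ws) \<subseteq> mat_kernel A"
      by (rule V.span_is_subset[OF ws kernel])
    show "mat_kernel A \<subseteq> V.span (set ws)"
      using reduce[of _ "length ws"] by auto
  qed
  then show ?thesis
    unfolding lattice_basis_def using ws indpt by simp
qed

section \<open>The kernel equations in terms of labels\<close>

lemma bij_betw_pos:
  assumes "distinct xs"
  shows "bij_betw (pos xs) (set xs) {..<length xs}"
proof (rule bij_betw_byWitness[where f' = "(!) xs"])
  show "\<forall>a'\<in>{..<length xs}. pos xs (xs ! a') = a'"
    using assms pos[of _ xs] nth_eq_iff_index_eq by (metis lessThan_iff nth_mem)
qed (use pos[of _ xs] in auto)

text \<open>Counting occurrences of \<open>r\<close> makes the first kind of row additive in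
  \<open>i\<close> and \<open>j\<close>, while the second kind depends only on \<open>i + j\<close>;
  both are visibly symmetric.\<close>

lemma B_entry_eq:
  "B_entry \<Delta> r (i, j) =
     (if r \<le> \<Delta> then (if i = r then 1 else 0) + (if j = r then 1 else 0)
      else if i + j = r + 1 - \<Delta> then 1 else 0)"
  unfolding B_entry_def by auto

lemma B_mat_mult_index:
  assumes v: "v \<in> carrier_vec (length (pairs \<Delta>))" and r: "r < 3 * \<Delta> - 1"
  shows "(B_mat \<Delta> *\<^sub>v v) $ r
           = (\<Sum>p\<in>set (pairs \<Delta>). B_entry \<Delta> (Suc r) p * v $ pos (pairs \<Delta>) p)"
proof -
  let ?xs = "pairs \<Delta>"
  have "(B_mat \<Delta> *\<^sub>v v) $ r = (\<Sum>c<length ?xs. B_entry \<Delta> (Suc r) (?xs ! c) * v $ c)"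
    using v r by (simp add: B_mat_def scalar_prod_def atLeast0LessThan)
  also have "\<dots> = (\<Sum>p\<in>set ?xs. B_entry \<Delta> (Suc r) (?xs ! pos ?xs p) * v $ pos ?xs p)"
    by (rule sum.reindex_bij_betw[OF bij_betw_pos[OF distinct_pairs], symmetric])
  finally show ?thesis by (simp add: pos)
qed

lemma mat_kernel_B_mat_iff:
  "v \<in> mat_kernel (B_mat \<Delta>) \<longleftrightarrow> v \<in> carrier_vec (length (pairs \<Delta>)) \<and>
     (\<forall>r<3 * \<Delta> - 1. (\<Sum>p\<in>set (pairs \<Delta>). B_entry \<Delta> (Suc r) p * v $ pos (pairs \<Delta>) p) = 0)"
proof -
  have dims: "dim_row (B_mat \<Delta>) = 3 * \<Delta> - 1" "dim_col (B_mat \<Delta>) = length (pairs \<Delta>)"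
    by (simp_all add: B_mat_def)
  have "B_mat \<Delta> *\<^sub>v v = 0\<^sub>v (3 * \<Delta> - 1) \<longleftrightarrow> (\<forall>r<3 * \<Delta> - 1. (B_mat \<Delta> *\<^sub>v v) $ r = 0)"
    by (auto simp: vec_eq_iff dims simp del: index_mult_mat_vec)
  then show ?thesis
    unfolding mat_kernel_def dims using B_mat_mult_index[of v \<Delta>] by auto
qed

section \<open>The vectors b and their membership in the kernel\<close>

lemma e_vec_carrier [simp]: "e_vec \<Delta> i j \<in> carrier_vec (length (pairs \<Delta>))"
  by (simp add: e_vec_def)

lemma e_vec_index:
  assumes p: "p \<in> set (pairs \<Delta>)" and ij: "i \<in> {1..\<Delta>}" "j \<in> {1..\<Delta>}"
  shows "e_vec \<Delta> i j $ pos (pairs \<Delta>) p = (if p = (min i j, max i j) then 1 else 0)"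
proof -
  have "(min i j, max i j) \<in> set (pairs \<Delta>)"
    using ij by (auto simp: set_pairs)
  then have "pos (pairs \<Delta>) p = pos (pairs \<Delta>) (min i j, max i j) \<longleftrightarrow> p = (min i j, max i j)"
    using p pos(2) by metis
  then show ?thesis
    using pos(1)[OF p] by (simp add: e_vec_def unit_vec_def)
qed

lemma b_vec_carrier [simp]: "b_vec \<Delta> q \<in> carrier_vec (length (pairs \<Delta>))"
  by (cases q) (simp add: b_vec_def Let_def)

lemma b_vec_index:
  assumes "p \<in> set (pairs \<Delta>)"
  shows "b_vec \<Delta> (i, j, k, l) $ pos (pairs \<Delta>) p =
    (let a = i + l - j; b = i + k - j; e = (\<lambda>i j. e_vec \<Delta> i j $ pos (pairs \<Delta>) p) in
       e i l + e a k + e j b - e i k - e j a - e b l)"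
  using pos(1)[OF assms] by (simp add: b_vec_def Let_def e_vec_def)

text \<open>The sum selects the sorted label, and symmetry of \<open>B_entry\<close> undoes the
  sorting, so the unsorted pairs in \<open>b_vec\<close> need no case distinction.\<close>

lemma B_entry_e_vec_sum:
  assumes "i \<in> {1..\<Delta>}" "j \<in> {1..\<Delta>}"
  shows "(\<Sum>p\<in>set (pairs \<Delta>). B_entry \<Delta> r p * e_vec \<Delta> i j $ pos (pairs \<Delta>) p) = B_entry \<Delta> r (i, j)"
proof -
  have mem: "(min i j, max i j) \<in> set (pairs \<Delta>)"
    using assms by (auto simp: set_pairs)
  have "(\<Sum>p\<in>set (pairs \<Delta>). B_entry \<Delta> r p * e_vec \<Delta> i j $ pos (pairs \<Delta>) p)
      = (\<Sum>p\<in>set (pairs \<Delta>). if p = (min i j, max i j) then B_entry \<Delta> r p else 0)"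
    by (rule sum.cong) (simp_all add: e_vec_index[OF _ assms])
  also have "\<dots> = B_entry \<Delta> r (min i j, max i j)"
    using mem by simp
  also have "\<dots> = B_entry \<Delta> r (i, j)"
    by (auto simp: B_entry_eq min_def max_def)
  finally show ?thesis .
qed

text \<open>Each of \<open>i, j, k, l, a, b\<close> occurs once in a positive and once in a negative
  term, which settles the rows \<open>r \<le> \<Delta>\<close>. The terms also match in pairs of
  equal index sum, \<open>i + l = j + a\<close>, \<open>a + k = b + l\<close>,
  \<open>j + b = i + k\<close>, which settles the others.\<close>

lemma b_vec_in_kernel:
  assumes "q \<in> set (quads \<Delta>)"
  shows "b_vec \<Delta> q \<in> mat_kernel (B_mat \<Delta>)"
proof -
  obtain i j k l where q: "q = (i, j, k, l)" by (cases q)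
  then have ord: "1 \<le> i" "i < j" "j < k" "k < l" "l \<le> \<Delta>"
    using assms by (auto simp: set_quads)
  define a b where "a = i + l - j" and "b = i + k - j"
  have ranges: "i \<in> {1..\<Delta>}" "j \<in> {1..\<Delta>}" "k \<in> {1..\<Delta>}" "l \<in> {1..\<Delta>}" "a \<in> {1..\<Delta>}" "b \<in> {1..\<Delta>}"
    using ord by (auto simp: a_def b_def)
  have sums: "j + a = i + l" "j + b = i + k" "b + l = a + k"
    using ord by (auto simp: a_def b_def)
  have "(\<Sum>p\<in>set (pairs \<Delta>). B_entry \<Delta> r p * b_vec \<Delta> q $ pos (pairs \<Delta>) p) = 0" for r
  proof -
    have "(\<Sum>p\<in>set (pairs \<Delta>). B_entry \<Delta> r p * b_vec \<Delta> q $ pos (pairs \<Delta>) p)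
        = B_entry \<Delta> r (i, l) + B_entry \<Delta> r (a, k) + B_entry \<Delta> r (j, b)
          - B_entry \<Delta> r (i, k) - B_entry \<Delta> r (j, a) - B_entry \<Delta> r (b, l)"
      by (simp add: q b_vec_index Let_def a_def[symmetric] b_def[symmetric] distrib_left
          right_diff_distrib sum.distrib sum_subtractf
          B_entry_e_vec_sum[OF ranges(1,4)] B_entry_e_vec_sum[OF ranges(5,3)]
          B_entry_e_vec_sum[OF ranges(2,6)] B_entry_e_vec_sum[OF ranges(1,3)]
          B_entry_e_vec_sum[OF ranges(2,5)] B_entry_e_vec_sum[OF ranges(6,4)])
    also have "\<dots> = 0"
    proof (cases "r \<le> \<Delta>")
      case True
      define f :: "nat \<Rightarrow> int" where "f s = (if s = r then 1 else 0)" for s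
      have "B_entry \<Delta> r (s, t) = f s + f t" for s t
        using True by (simp add: B_entry_eq f_def)
      then show ?thesis by simp
    next
      case False
      define g :: "nat \<Rightarrow> int" where "g s = (if s = r + 1 - \<Delta> then 1 else 0)" for s
      have "B_entry \<Delta> r (s, t) = g (s + t)" for s t
        using False by (simp add: B_entry_eq g_def)
      then show ?thesis by (simp add: sums)
    qed
    finally show ?thesis .
  qed
  then show ?thesis
    by (simp add: mat_kernel_B_mat_iff)
qed

section \<open>Triangularity on the labels in R\<close>

lemma b_vec_R_index:
  assumes xy: "(x, y) \<in> R_set \<Delta>" and uv: "(u, v) \<in> R_set \<Delta>"
    and lex: "x < u \<or> x = u \<and> y \<le> v"
  shows "b_vec \<Delta> (R_to_I (x, y)) $ pos (pairs \<Delta>) (u, v) = (if (u, v) = (x, y) then 1 else 0)"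
proof -
  have ord: "2 < x" "x \<le> y" "y < \<Delta>" "2 < u" "u \<le> v" "v < \<Delta>"
    using xy uv by (auto simp: R_set_def)
  have mem: "(u, v) \<in> set (pairs \<Delta>)" using ord by (auto simp: set_pairs)
  \<comment> \<open>The auxiliary indices of \<open>b_vec\<close> for this quadruple are
    \<open>a = x\<close> and \<open>b = x - 1\<close>.\<close>
  have ab: "1 + (y + 1) - (y - x + 2) = x" "1 + y - (y - x + 2) = x - 1"
    using ord by auto
  have ranges: "1 \<in> {1..\<Delta>}" "y + 1 \<in> {1..\<Delta>}" "x \<in> {1..\<Delta>}" "y \<in> {1..\<Delta>}"
    "y - x + 2 \<in> {1..\<Delta>}" "x - 1 \<in> {1..\<Delta>}"
    using ord by auto
  have diag: "(u, v) = (min x y, max x y) \<longleftrightarrow> (u, v) = (x, y)"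
    using ord by simp
  \<comment> \<open>By \<open>lex\<close>, \<open>x \<le> u\<close>, so labels starting at most at
    \<open>x - 1\<close> are too small; those starting with 1 fail since
    \<open>2 < u\<close>.\<close>
  have "min (y - x + 2) (x - 1) < u" "min (x - 1) (y + 1) < u"
    using ord lex by auto
  then have off: "(u, v) = (min 1 (y + 1), max 1 (y + 1)) \<longleftrightarrow> False"
    "(u, v) = (min 1 y, max 1 y) \<longleftrightarrow> False"
    "(u, v) = (min (y - x + 2) (x - 1), max (y - x + 2) (x - 1)) \<longleftrightarrow> False"
    "(u, v) = (min (x - 1) (y + 1), max (x - 1) (y + 1)) \<longleftrightarrow> False"
    using ord by auto
  \<comment> \<open>This label may itself start with \<open>x\<close>; then its second entry is
    \<open>y - x + 2\<close>, which is below \<open>y\<close> because \<open>2 < x\<close>.\<close>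
  have off': "(u, v) = (min (y - x + 2) x, max (y - x + 2) x) \<longleftrightarrow> False"
  proof (cases "y - x + 2 < x")
    case False
    then have "min (y - x + 2) x = x" "max (y - x + 2) x = y - x + 2" "y - x + 2 < y"
      using ord by auto
    then show ?thesis using ord lex by auto
  qed (use lex in auto)
  show ?thesis
    unfolding R_to_I_def prod.case b_vec_index[OF mem] Let_def ab
    unfolding e_vec_index[OF mem ranges(1,2)] e_vec_index[OF mem ranges(3,4)]
      e_vec_index[OF mem ranges(5,6)] e_vec_index[OF mem ranges(1,4)]
      e_vec_index[OF mem ranges(5,3)] e_vec_index[OF mem ranges(6,2)]
    unfolding diag off off' by simp
qed

section \<open>Kernel vectors vanishing on R\<close>

lemma kernel_vanishing_on_R:
  assumes v: "v \<in> mat_kernel (B_mat \<Delta>)"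
    and R: "\<And>p. p \<in> R_set \<Delta> \<Longrightarrow> v $ pos (pairs \<Delta>) p = 0"
  shows "v = 0\<^sub>v (length (pairs \<Delta>))"
proof -
  let ?P = "set (pairs \<Delta>)"
  define x where "x i j = v $ pos (pairs \<Delta>) (i, j)" for i j
  have vc: "v \<in> carrier_vec (length (pairs \<Delta>))"
    using v by (simp add: mat_kernel_B_mat_iff)
  have rows: "(\<Sum>(i, j)\<in>?P. B_entry \<Delta> r (i, j) * x i j) = 0"
    if "1 \<le> r" "r \<le> 3 * \<Delta> - 1" for r
  proof -
    have "r - 1 < 3 * \<Delta> - 1" and "Suc (r - 1) = r" using that by auto
    then show ?thesis
      using v unfolding mat_kernel_B_mat_iff x_def case_prod_unfold prod.collapse by metis
  qed
  \<comment> \<open>Each equation below is a row of \<open>B_mat\<close> cut down to the labels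
    \<open>T\<close> not yet known to contribute zero.\<close>
  have restrict: "(\<Sum>(i, j)\<in>T. B_entry \<Delta> r (i, j) * x i j) = 0"
    if "1 \<le> r" "r \<le> 3 * \<Delta> - 1" "T \<subseteq> ?P"
      "\<And>i j. (i, j) \<in> ?P - T \<Longrightarrow> B_entry \<Delta> r (i, j) * x i j = 0" for r T
  proof -
    have "(\<Sum>(i, j)\<in>?P. B_entry \<Delta> r (i, j) * x i j) = (\<Sum>(i, j)\<in>T. B_entry \<Delta> r (i, j) * x i j)"
      by (rule sum.mono_neutral_right) (use that(3,4) in auto)
    then show ?thesis using rows[OF that(1,2)] by simp
  qed
  have xR: "x i j = 0" if "2 < i" "i \<le> j" "j < \<Delta>" for i j
    using R[of "(i, j)"] that by (simp add: x_def R_set_def)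
  \<comment> \<open>Row \<open>2 * \<Delta> + m - 1\<close> is the sum row for
    \<open>i + j = \<Delta> + m\<close>; its other labels have \<open>i > m\<close> and
    \<open>j < \<Delta>\<close>, hence lie in R.\<close>
  have x_last: "x m \<Delta> = 0" if "2 \<le> m" "m \<le> \<Delta>" for m
  proof -
    have "(\<Sum>(i, j)\<in>{(m, \<Delta>)}. B_entry \<Delta> (2 * \<Delta> + m - 1) (i, j) * x i j) = 0"
      by (rule restrict) (use that xR in \<open>auto simp: set_pairs B_entry_eq\<close>)
    then show ?thesis using that by (simp add: B_entry_eq split: if_splits)
  qed
  \<comment> \<open>The index sums 2 and 3 are each attained by a single label.\<close>
  have x11: "x 1 1 = 0" if "1 \<le> \<Delta>"
  proof -
    have "(\<Sum>(i, j)\<in>{(1, 1)}. B_entry \<Delta> (\<Delta> + 1) (i, j) * x i j) = 0"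
      by (rule restrict) (use that in \<open>auto simp: set_pairs B_entry_eq\<close>)
    then show ?thesis by (simp add: B_entry_eq)
  qed
  have x12: "x 1 2 = 0" if "2 \<le> \<Delta>"
  proof -
    have "(\<Sum>(i, j)\<in>{(1, 2)}. B_entry \<Delta> (\<Delta> + 2) (i, j) * x i j) = 0"
      by (rule restrict) (use that in \<open>auto simp: set_pairs B_entry_eq\<close>)
    then show ?thesis by (simp add: B_entry_eq)
  qed
  \<comment> \<open>Sum row for \<open>i + j = m + 2\<close>: labels with \<open>i > 2\<close> lie
    in R.\<close>
  have diagonal: "x 1 (m + 1) + x 2 m = 0" if "2 \<le> m" "m + 1 \<le> \<Delta>" for m
  proof -
    have "(\<Sum>(i, j)\<in>{(1, m + 1), (2, m)}. B_entry \<Delta> (\<Delta> + m + 1) (i, j) * x i j) = 0"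
    proof (rule restrict)
      fix i j assume ij: "(i, j) \<in> ?P - {(1, m + 1), (2, m)}"
      show "B_entry \<Delta> (\<Delta> + m + 1) (i, j) * x i j = 0"
      proof (cases "i + j = m + 2")
        case True
        then have "2 < i" "i \<le> j" "j < \<Delta>"
          using ij that by (auto simp: set_pairs)
        then show ?thesis using xR by simp
      qed (simp add: B_entry_eq)
    qed (use that in \<open>auto simp: set_pairs\<close>)
    then show ?thesis by (simp add: B_entry_eq)
  qed
  \<comment> \<open>Row \<open>a\<close> of the first kind: its remaining labels lie in R or end in
    \<Delta>, where \<open>x_last\<close> applies.\<close>
  have column: "x 1 a + x 2 a = 0" if "2 < a" "a < \<Delta>" for a
  proof -
    have "(\<Sum>(i, j)\<in>{(1, a), (2, a)}. B_entry \<Delta> a (i, j) * x i j) = 0"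
    proof (rule restrict)
      fix i j assume ij: "(i, j) \<in> ?P - {(1, a), (2, a)}"
      show "B_entry \<Delta> a (i, j) * x i j = 0"
      proof (cases "i = a \<or> j = a")
        case True
        then have "2 < i" "i \<le> j" "j \<le> \<Delta>"
          using ij that by (auto simp: set_pairs)
        then show ?thesis using xR[of i j] x_last[of i] by (cases "j = \<Delta>") auto
      qed (use that in \<open>simp add: B_entry_eq\<close>)
    qed (use that in \<open>auto simp: set_pairs\<close>)
    then show ?thesis using that by (simp add: B_entry_eq)
  qed
  have x1_last: "x 1 \<Delta> = 0" if "2 < \<Delta>"
  proof -
    have "(\<Sum>(i, j)\<in>{(1, \<Delta>)}. B_entry \<Delta> \<Delta> (i, j) * x i j) = 0"
    proof (rule restrict)
      fix i j assume ij: "(i, j) \<in> ?P - {(1, \<Delta>)}"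
      show "B_entry \<Delta> \<Delta> (i, j) * x i j = 0"
      proof (cases "j = \<Delta>")
        case True
        then show ?thesis using ij x_last[of i] by (auto simp: set_pairs)
      qed (use ij in \<open>auto simp: B_entry_eq set_pairs\<close>)
    qed (use that in \<open>auto simp: set_pairs\<close>)
    then show ?thesis using that by (simp add: B_entry_eq)
  qed
  \<comment> \<open>\<open>diagonal\<close> and \<open>column\<close> together give
    \<open>x 1 m = x 1 (m + 1)\<close>, so the zero at \<Delta> propagates downwards.\<close>
  have x1: "x 1 m = 0" if "2 < m" "m \<le> \<Delta>" for m
    using that(2,1)
  proof (induction m rule: inc_induct)
    case base
    then show ?case using x1_last by simp
  next
    case (step m)
    then have "x 1 (Suc m) = 0" by simp
    then show ?case using diagonal[of m] column[of m] step.hyps step.prems by simp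
  qed
  have x2: "x 2 m = 0" if "2 \<le> m" "m \<le> \<Delta>" for m
  proof (cases "m = \<Delta>")
    case True
    then show ?thesis using x_last[of 2] that by simp
  next
    case False
    then show ?thesis using diagonal[of m] x1[of "m + 1"] that by simp
  qed
  have all_zero: "x i j = 0" if "1 \<le> i" "i \<le> j" "j \<le> \<Delta>" for i j
  proof -
    consider "i = 1" "j = 1" | "i = 1" "j = 2" | "i = 1" "2 < j" | "i = 2" | "2 < i" "j < \<Delta>"
      | "2 < i" "j = \<Delta>"
      using \<open>1 \<le> i\<close> \<open>i \<le> j\<close> \<open>j \<le> \<Delta>\<close> by linarith
    then show ?thesis
      using x11 x12 x1[of j] x2[of j] xR[of i j] x_last[of i] that by cases auto
  qed
  show ?thesis
  proof (rule eq_vecI)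
    fix c assume "c < dim_vec (0\<^sub>v (length (pairs \<Delta>)) :: int vec)"
    then have "c \<in> pos (pairs \<Delta>) ` ?P"
      using bij_betw_imp_surj_on[OF bij_betw_pos[OF distinct_pairs]] by simp
    then show "v $ c = 0\<^sub>v (length (pairs \<Delta>)) $ c"
      using all_zero pos(1)[of _ "pairs \<Delta>"] by (auto simp: x_def set_pairs)
  qed (use vc in simp)
qed

section \<open>From labels to list positions, and the conclusion\<close>

lemma R_list_lexicographic:
  "sorted_wrt (\<lambda>(u, v) (u', v'). u < u' \<or> u = u' \<and> v < v') (R_list \<Delta>)"
  unfolding R_list_def by (rule sorted_wrt_filter[OF pairs_lexicographic])

text \<open>Positions in \<open>R_list\<close> follow the lexicographic order, so
  \<open>q \<le> p\<close> provides the order hypothesis of \<open>b_vec_R_index\<close>. This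
  serves both the submatrix and the basis.\<close>

lemma b_vec_R_list_index:
  assumes p: "p < length (R_list \<Delta>)" and q: "q \<le> p"
  shows "b_vec \<Delta> (R_to_I (R_list \<Delta> ! q)) $ pos (pairs \<Delta>) (R_list \<Delta> ! p) = (if q = p then 1 else 0)"
proof -
  obtain x y where xy: "R_list \<Delta> ! q = (x, y)" by fastforce
  obtain u v where uv: "R_list \<Delta> ! p = (u, v)" by fastforce
  have mem: "(x, y) \<in> R_set \<Delta>" "(u, v) \<in> R_set \<Delta>"
    using nth_mem[of q "R_list \<Delta>"] nth_mem[of p "R_list \<Delta>"] p q
    by (simp_all add: xy uv set_R_list)
  have "x < u \<or> x = u \<and> y < v" if "q < p"
    using sorted_wrt_nth_less[OF R_list_lexicographic that p] by (simp add: xy uv)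
  moreover have "x = u \<and> y = v" if "q = p" using that xy uv by simp
  ultimately have "x < u \<or> x = u \<and> y \<le> v" "(u, v) = (x, y) \<longleftrightarrow> q = p"
    using q by (cases "q = p"; auto)+
  then show ?thesis
    unfolding xy uv using b_vec_R_index[OF mem] by simp
qed

text \<open>The labels do occur in \<open>pairs\<close> and \<open>quads\<close>, so looking up
  their positions returns the same labels.\<close>

lemma M_R_I_index:
  assumes "p < length (R_list \<Delta>)" "q < length (R_list \<Delta>)"
  shows "M_R_I \<Delta> $$ (p, q) = b_vec \<Delta> (R_to_I (R_list \<Delta> ! q)) $ pos (pairs \<Delta>) (R_list \<Delta> ! p)"
proof -
  have "R_to_I (R_list \<Delta> ! q) \<in> set (quads \<Delta>)"
    using assms(2) nth_mem[of q "R_list \<Delta>"] I_set_subset[of \<Delta>]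
    by (auto simp: set_R_list I_set_def)
  moreover have "R_list \<Delta> ! p \<in> set (pairs \<Delta>)"
    using nth_mem[OF assms(1)] by (simp add: R_list_def)
  ultimately show ?thesis
    using assms pos[of _ "pairs \<Delta>"] pos[of _ "quads \<Delta>"]
    by (simp add: M_R_I_def submatrix_by_def M_mat_def I_list_def mat_of_cols_index)
qed

theorem theorem4p6:
  fixes \<Delta> :: nat
  assumes "\<Delta> \<ge> 1"
  shows "upper_triangular (M_R_I \<Delta>)
       \<and> (\<forall>p < dim_row (M_R_I \<Delta>). M_R_I \<Delta> $$ (p, p) \<noteq> 0)
       \<and> lattice_basis (B_mat \<Delta>) {b_vec \<Delta> q | q. q \<in> I_set \<Delta>}"
proof (intro conjI)
  have dim: "dim_row (M_R_I \<Delta>) = length (R_list \<Delta>)"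
    by (simp add: M_R_I_def submatrix_by_def)
  show "upper_triangular (M_R_I \<Delta>)"
    by (auto simp: dim M_R_I_index b_vec_R_list_index)
  show "\<forall>p < dim_row (M_R_I \<Delta>). M_R_I \<Delta> $$ (p, p) \<noteq> 0"
    by (simp add: dim M_R_I_index b_vec_R_list_index)
  let ?ps = "map (pos (pairs \<Delta>)) (R_list \<Delta>)" and ?ws = "map (b_vec \<Delta>) (I_list \<Delta>)"
  have dim_col: "dim_col (B_mat \<Delta>) = length (pairs \<Delta>)"
    by (simp add: B_mat_def)
  have len: "length (I_list \<Delta>) = length (R_list \<Delta>)"
    by (simp add: I_list_def)
  have "lattice_basis (B_mat \<Delta>) (set ?ws)"
  proof (rule lattice_basis_of_unitriangular[where ps = ?ps])
    fix p assume "p < length ?ws"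
    then have "R_list \<Delta> ! p \<in> set (pairs \<Delta>)"
      using nth_mem[of p "R_list \<Delta>"] by (simp add: len R_list_def)
    then show "?ps ! p < dim_col (B_mat \<Delta>)"
      using \<open>p < length ?ws\<close> pos(1) by (simp add: len dim_col)
  next
    show "set ?ws \<subseteq> mat_kernel (B_mat \<Delta>)"
      using b_vec_in_kernel[OF subsetD[OF I_set_subset]] by (auto simp: set_I_list)
  next
    fix v assume v: "v \<in> mat_kernel (B_mat \<Delta>)"
      and zero: "\<And>p. p < length ?ws \<Longrightarrow> v $ (?ps ! p) = 0"
    \<comment> \<open>Vanishing at all pivots means vanishing on R, since \<open>R_list\<close>
      enumerates R.\<close>
    have "v $ pos (pairs \<Delta>) r = 0" if "r \<in> R_set \<Delta>" for r
      using that zero by (auto simp: len set_R_list[symmetric] in_set_conv_nth)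
    then show "v = 0\<^sub>v (dim_col (B_mat \<Delta>))"
      unfolding dim_col using v by (rule kernel_vanishing_on_R[rotated])
  \<comment> \<open>Left over are the equal lengths, the unit diagonal and the zeros below
    it.\<close>
  qed (simp_all add: I_list_def b_vec_R_list_index)
  moreover have "set ?ws = {b_vec \<Delta> q | q. q \<in> I_set \<Delta>}"
    by (auto simp: set_I_list)
  ultimately show "lattice_basis (B_mat \<Delta>) {b_vec \<Delta> q | q. q \<in> I_set \<Delta>}" by simp
qed

end
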